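(* Let $N\ge 1$, let $\Omega\subset\mathbb{R}^N$ be a bounded open set with Lipschitz continuous boundary, and let $0<s<1$, $\delta\ge0$, $T>0$. Let $(\psi_0,\psi_1)\in W_0^{s,2}(\overline\Omega)\times L^2(\Omega)$ and let $(\psi,\psi_t)$ be the unique weak solution of the backward system $$\begin{cases}\psi_{tt}+(-\Delta)^s\psi-\delta(-\Delta)^s\psi_t=0 & \text{in }\Omega\times(0,T),\\ \psi=0 & \text{in }(\mathbb{R}^N\setminus\Omega)\times(0,T),\\ \psi(\cdot,T)=\psi_0,\quad \psi_t(\cdot,T)=\psi_1 & \text{in }\Omega.\end{cases}$$ Let $\mathcal{O}\subset\mathbb{R}^N\setminus\Omega$ be an arbitrary non-empty open set. If $\mathcal{N}_s\psi=0$ in $\mathcal{O}\times(0,T)$, then $\psi=0$ in $\Omega\times(0,T)$.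
   Context: Fractional Laplacian: $(-\Delta)^su(x)=C_{N,s}\,\mathrm{P.V.}\int_{\mathbb{R}^N}\frac{u(x)-u(y)}{|x-y|^{N+2s}}\,dy$, with $C_{N,s}=\frac{s2^{2s}\Gamma((2s+N)/2)}{\pi^{N/2}\Gamma(1-s)}$. Spaces: $W^{s,2}(\mathbb{R}^N)=\{u\in L^2(\mathbb{R}^N):\int_{\mathbb{R}^N}\int_{\mathbb{R}^N}\frac{|u(x)-u(y)|^2}{|x-y|^{N+2s}}dxdy<\infty\}$; $W_0^{s,2}(\overline\Omega)=\{u\in W^{s,2}(\mathbb{R}^N):u=0\text{ in }\mathbb{R}^N\setminus\Omega\}$; $W^{-s,2}(\overline\Omega)$ is the dual of $W_0^{s,2}(\overline\Omega)$, with duality pairing $\langle\cdot,\cdot\rangle_{-\frac12,\frac12}$ and the Gelfand triple $W_0^{s,2}(\overline\Omega)\hookrightarrow L^2(\Omega)\hookrightarrow W^{-s,2}(\overline\Omega)$. For $f,\zeta\in W_0^{s,2}(\overline\Omega)$, $\langle(-\Delta)^sf,\zeta\rangle_{-\frac12,\frac12}=\frac{C_{N,s}}{2}\int_{\mathbb{R}^N}\int_{\mathbb{R}^N}\frac{(f(x)-f(y))(\zeta(x)-\zeta(y))}{|x-y|^{N+2s}}dxdy$. Nonlocal normal derivative: for $u\in W^{s,2}(\mathbb{R}^N)$, $\mathcal{N}_su(x)=C_{N,s}\int_\Omega\frac{u(x)-u(y)}{|x-y|^{N+2s}}\,dy$ for $x\in\mathbb{R}^N\setminus\overline\Omega$;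 $\mathcal{N}_s\psi(x,t)$ means $\mathcal{N}_s$ applied to $\psi(\cdot,t)$. Weak solution: $(\psi,\psi_t)$ is a weak solution of the backward system if $\psi\in C([0,T];W_0^{s,2}(\overline\Omega))\cap C^1([0,T];L^2(\Omega))$, $\psi_{tt}\in C((0,T);W^{-s,2}(\overline\Omega))$, $\psi(\cdot,T)=\psi_0$ and $\psi_t(\cdot,T)=\psi_1$ in $\Omega$, and for every $\zeta\in W_0^{s,2}(\overline\Omega)$ and a.e. $t\in(0,T)$, $\langle\psi_{tt},\zeta\rangle_{-\frac12,\frac12}+\langle(-\Delta)^s(\psi-\delta\psi_t),\zeta\rangle_{-\frac12,\frac12}=0$. *)

theory Defs
  imports "HOL-Analysis.Analysis"
begin

text \<open>
  Elements of the function spaces below are represented by functions, identified when they agree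
  almost everywhere; all conditions are therefore stated almost everywhere.  A function in
  \<open>L\<^sup>2(\<Omega>)\<close> is represented by a function on the whole space whose values outside \<open>\<Omega>\<close> are irrelevant.
\<close>

text \<open>
  Near each boundary point the set is, in suitable rotated coordinates, the part strictly above the
  graph of a Lipschitz function.  The direction \<open>e\<close> is the last coordinate axis and
  \<open>x - (x \<bullet> e) *\<^sub>R e\<close> is the projection of \<open>x\<close> to the hyperplane of the other coordinates.
\<close>

definition lipschitz_boundary :: "(real ^ 'n) set \<Rightarrow> bool" where
  "lipschitz_boundary \<Omega> \<longleftrightarrow>
     (\<forall>p \<in> frontier \<Omega>. \<exists>r > 0. \<exists>e. norm e = 1 \<and>
        (\<exists>(g :: real ^ 'n \<Rightarrow> real) L. L-lipschitz_on {y. y \<bullet> e = 0} g \<and>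
           \<Omega> \<inter> ball p r = {x \<in> ball p r. x \<bullet> e > g (x - (x \<bullet> e) *\<^sub>R e)}))"

definition L2 :: "(real ^ 'n) set \<Rightarrow> (real ^ 'n \<Rightarrow> real) set" where
  "L2 \<Omega> = {u. u \<in> borel_measurable (lebesgue_on \<Omega>) \<and> integrable (lebesgue_on \<Omega>) (\<lambda>x. (u x)\<^sup>2)}"

definition L2_norm_on :: "(real ^ 'n) set \<Rightarrow> (real ^ 'n \<Rightarrow> real) \<Rightarrow> real" where
  "L2_norm_on \<Omega> u = sqrt (LINT x|lebesgue_on \<Omega>. (u x)\<^sup>2)"

text \<open>On the diagonal this is 0, so by \<open>x / 0 = 0\<close> the quotients below vanish there.\<close>

definition kern :: "real \<Rightarrow> real ^ 'n \<Rightarrow> real ^ 'n \<Rightarrow> real" where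
  "kern s x y = norm (x - y) powr (real CARD('n) + 2 * s)"

definition Ws2 :: "real \<Rightarrow> (real ^ 'n \<Rightarrow> real) set" where
  "Ws2 s = {u \<in> L2 UNIV. integrable lebesgue (\<lambda>(x, y). \<bar>u x - u y\<bar>\<^sup>2 / kern s x y)}"

definition Ws2_norm :: "real \<Rightarrow> (real ^ 'n \<Rightarrow> real) \<Rightarrow> real" where
  "Ws2_norm s u =
     sqrt ((LINT x|lebesgue. (u x)\<^sup>2) + (LINT (x, y)|lebesgue. \<bar>u x - u y\<bar>\<^sup>2 / kern s x y))"

definition Ws2_0 :: "real \<Rightarrow> (real ^ 'n) set \<Rightarrow> (real ^ 'n \<Rightarrow> real) set" where
  "Ws2_0 s \<Omega> = {u \<in> Ws2 s. AE x in lebesgue. x \<notin> \<Omega> \<longrightarrow> u x = 0}"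

text \<open>
  The dual of \<open>Ws2_0 s \<Omega>\<close>.  Only the values of a functional on \<open>Ws2_0 s \<Omega>\<close> matter.  Boundedness
  forces a functional to agree on functions that coincide almost everywhere.  The duality pairing
  is application.
\<close>

definition Ws2_dual :: "real \<Rightarrow> (real ^ 'n) set \<Rightarrow> ((real ^ 'n \<Rightarrow> real) \<Rightarrow> real) set" where
  "Ws2_dual s \<Omega> = {F.
     (\<forall>u \<in> Ws2_0 s \<Omega>. \<forall>v \<in> Ws2_0 s \<Omega>. F (\<lambda>x. u x + v x) = F u + F v) \<and>
     (\<forall>c. \<forall>u \<in> Ws2_0 s \<Omega>. F (\<lambda>x. c * u x) = c * F u) \<and>
     (\<exists>C. \<forall>u \<in> Ws2_0 s \<Omega>. \<bar>F u\<bar> \<le> C * Ws2_norm s u)}"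

definition Ws2_dual_norm :: "real \<Rightarrow> (real ^ 'n) set \<Rightarrow> ((real ^ 'n \<Rightarrow> real) \<Rightarrow> real) \<Rightarrow> real" where
  "Ws2_dual_norm s \<Omega> F = (SUP u \<in> {u \<in> Ws2_0 s \<Omega>. Ws2_norm s u \<le> 1}. \<bar>F u\<bar>)"

text \<open>The embedding of \<open>L\<^sup>2(\<Omega>)\<close> into the dual in the Gelfand triple.\<close>

definition L2_to_dual :: "(real ^ 'n) set \<Rightarrow> (real ^ 'n \<Rightarrow> real) \<Rightarrow> (real ^ 'n \<Rightarrow> real) \<Rightarrow> real" where
  "L2_to_dual \<Omega> u \<zeta> = (LINT x|lebesgue_on \<Omega>. u x * \<zeta> x)"

definition C_Ns :: "'n::finite itself \<Rightarrow> real \<Rightarrow> real" where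
  "C_Ns _ s = s * 2 powr (2 * s) * Gamma ((2 * s + real CARD('n)) / 2) /
     (pi powr (real CARD('n) / 2) * Gamma (1 - s))"

text \<open>
  The fractional Laplacian in its weak form, as a map from \<open>Ws2_0 s \<Omega>\<close> to its dual; the factor 1/2
  comes from symmetrizing the principal value integral tested against \<open>\<zeta>\<close>.
\<close>

definition frac_laplacian :: "real \<Rightarrow> (real ^ 'n \<Rightarrow> real) \<Rightarrow> (real ^ 'n \<Rightarrow> real) \<Rightarrow> real" where
  "frac_laplacian s f \<zeta> =
     C_Ns TYPE('n) s / 2 * (LINT (x, y)|lebesgue. (f x - f y) * (\<zeta> x - \<zeta> y) / kern s x y)"

definition nonlocal_normal_deriv ::
  "real \<Rightarrow> (real ^ 'n) set \<Rightarrow> (real ^ 'n \<Rightarrow> real) \<Rightarrow> real ^ 'n \<Rightarrow> real" where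
  "nonlocal_normal_deriv s \<Omega> u x =
     C_Ns TYPE('n) s * (LINT y|lebesgue_on \<Omega>. (u x - u y) / kern s x y)"

text \<open>Continuity and differentiability, relative to \<open>I\<close>, of curves in a space normed by \<open>nrm\<close>.\<close>

definition continuous_wrt ::
  "(('a \<Rightarrow> real) \<Rightarrow> real) \<Rightarrow> real set \<Rightarrow> (real \<Rightarrow> 'a \<Rightarrow> real) \<Rightarrow> bool" where
  "continuous_wrt nrm I f \<longleftrightarrow>
     (\<forall>t \<in> I. ((\<lambda>r. nrm (\<lambda>x. f r x - f t x)) \<longlongrightarrow> 0) (at t within I))"

definition has_derivative_wrt ::
  "(('a \<Rightarrow> real) \<Rightarrow> real) \<Rightarrow> real set \<Rightarrow> (real \<Rightarrow> 'a \<Rightarrow> real) \<Rightarrow> (real \<Rightarrow> 'a \<Rightarrow> real) \<Rightarrow> bool" where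
  "has_derivative_wrt nrm I f f' \<longleftrightarrow>
     (\<forall>t \<in> I. ((\<lambda>r. nrm (\<lambda>x. (f r x - f t x) / (r - t) - f' t x)) \<longlongrightarrow> 0) (at t within I))"

definition zero_extension :: "(real ^ 'n) set \<Rightarrow> (real ^ 'n \<Rightarrow> real) \<Rightarrow> real ^ 'n \<Rightarrow> real" where
  "zero_extension \<Omega> u x = (if x \<in> \<Omega> then u x else 0)"

text \<open>
  Here \<open>\<psi>t\<close> is the time derivative of \<open>\<psi>\<close> in \<open>L\<^sup>2(\<Omega>)\<close>, and \<open>\<psi>tt\<close> is the derivative of \<open>\<psi>t\<close> in the dual
  space, \<open>L\<^sup>2(\<Omega>)\<close> being embedded there by the Gelfand triple.  For \<open>\<delta> > 0\<close> the values of \<open>\<psi>t\<close> are a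
  priori only in \<open>L\<^sup>2(\<Omega>)\<close>; that \<open>(-\<Delta>)\<^sup>s (\<psi> - \<delta> \<psi>t)\<close> makes sense in the dual is the requirement that
  \<open>\<psi> - \<delta> \<psi>t\<close> (extended by zero) lies in \<open>Ws2_0 s \<Omega>\<close> for almost every time.
\<close>

definition weak_solution ::
  "(real ^ 'n) set \<Rightarrow> real \<Rightarrow> real \<Rightarrow> real \<Rightarrow> (real ^ 'n \<Rightarrow> real) \<Rightarrow> (real ^ 'n \<Rightarrow> real) \<Rightarrow>
   (real \<Rightarrow> real ^ 'n \<Rightarrow> real) \<Rightarrow> (real \<Rightarrow> real ^ 'n \<Rightarrow> real) \<Rightarrow> bool" where
  "weak_solution \<Omega> s \<delta> T \<psi>0 \<psi>1 \<psi> \<psi>t \<longleftrightarrow>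
     (\<forall>t \<in> {0..T}. \<psi> t \<in> Ws2_0 s \<Omega>) \<and>
     continuous_wrt (Ws2_norm s) {0..T} \<psi> \<and>
     (\<forall>t \<in> {0..T}. \<psi>t t \<in> L2 \<Omega>) \<and>
     has_derivative_wrt (L2_norm_on \<Omega>) {0..T} \<psi> \<psi>t \<and>
     continuous_wrt (L2_norm_on \<Omega>) {0..T} \<psi>t \<and>
     (AE x in lebesgue_on \<Omega>. \<psi> T x = \<psi>0 x) \<and>
     (AE x in lebesgue_on \<Omega>. \<psi>t T x = \<psi>1 x) \<and>
     (AE t in lebesgue_on {0<..<T}. zero_extension \<Omega> (\<lambda>x. \<psi> t x - \<delta> * \<psi>t t x) \<in> Ws2_0 s \<Omega>) \<and>
     (\<exists>\<psi>tt :: real \<Rightarrow> (real ^ 'n \<Rightarrow> real) \<Rightarrow> real.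
        (\<forall>t \<in> {0<..<T}. \<psi>tt t \<in> Ws2_dual s \<Omega>) \<and>
        has_derivative_wrt (Ws2_dual_norm s \<Omega>) {0<..<T} (\<lambda>t. L2_to_dual \<Omega> (\<psi>t t)) \<psi>tt \<and>
        continuous_wrt (Ws2_dual_norm s \<Omega>) {0<..<T} \<psi>tt \<and>
        (\<forall>\<zeta> \<in> Ws2_0 s \<Omega>. AE t in lebesgue_on {0<..<T}.
           \<psi>tt t \<zeta> + frac_laplacian s (zero_extension \<Omega> (\<lambda>x. \<psi> t x - \<delta> * \<psi>t t x)) \<zeta> = 0))"

end

theory Submission
  imports Defs "HOL-Real_Asymp.Real_Asymp"
begin

text \<open>
  Unique continuation is already static: at almost every time, and for \<open>x\<close> in \<open>\<O>\<close>, the hypothesis says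
  that the Riesz-type potential \<open>\<integral> w(y) |x - y|\<^sup>-\<^sup>2\<^sup>a dy\<close> of \<open>w = \<psi>(t)\<close>, with \<open>a = N/2 + s\<close>, vanishes.  Applying
  the Laplacian in \<open>x\<close> replaces \<open>a\<close> by \<open>a + 1\<close>, up to the nonzero factor \<open>2a(2a + 2 - N)\<close>.  Iterating and
  using Weierstrass' theorem in the variable \<open>|x - y|\<^sup>-\<^sup>2\<close>, \<open>w\<close> is orthogonal to every radial function
  centred in \<open>\<O>\<close>, in particular to all Gaussians centred in a ball of \<open>\<O>\<close>.  A product of two such
  Gaussians is a multiple of a third one, centred at a convex combination of the centres; so their
  span is an algebra, dense by Stone-Weierstrass, and \<open>w = 0\<close>.  Continuity in time covers the
  exceptional times.
\<close>

section \<open>Riesz kernels and their second derivatives\<close>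

text \<open>This is the norm of \<open>v\<close> to the power \<open>-2a\<close>, written through
  the inner product so that along a line it becomes a power of a quadratic polynomial. At the origin
  it is 0, because \<open>0 powr _ = 0\<close>; this matches the value of
  \<open>1 / kern s x y\<close> on the diagonal.\<close>

definition riesz :: "real \<Rightarrow> 'a::euclidean_space \<Rightarrow> real" where
  "riesz a v = (v \<bullet> v) powr - a"

text \<open>The second derivative of \<open>riesz a\<close> in the direction of a unit vector \<open>e\<close>.\<close>

definition riesz_dd :: "real \<Rightarrow> 'a::euclidean_space \<Rightarrow> 'a \<Rightarrow> real" where
  "riesz_dd a e v = 4 * a * (a + 1) * (v \<bullet> e)\<^sup>2 * riesz (a + 2) v - 2 * a * riesz (a + 1) v"

lemma riesz_measurable [measurable]: "riesz a \<in> borel_measurable borel"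
  unfolding riesz_def[abs_def] by measurable

lemma continuous_on_riesz: "0 \<notin> S \<Longrightarrow> continuous_on S (riesz a)"
  unfolding riesz_def[abs_def] by (intro continuous_intros) auto

lemma continuous_on_riesz_dd: "0 \<notin> S \<Longrightarrow> continuous_on S (riesz_dd a e)"
  unfolding riesz_dd_def[abs_def] by (intro continuous_intros continuous_on_riesz)

text \<open>Summing \<open>(v \<bullet> e)\<^sup>2\<close> over the basis gives
  \<open>v \<bullet> v\<close>, which lowers the exponent \<open>a + 2\<close> to
  \<open>a + 1\<close>; the coefficients then add up to
  \<open>4a(a + 1) - 2a DIM('a)\<close>.\<close>

lemma riesz_laplacian:
  fixes v :: "'a::euclidean_space"
  assumes "v \<noteq> 0"
  shows "(\<Sum>e\<in>Basis. riesz_dd a e v) = 2 * a * (2 * a + 2 - DIM('a)) * riesz (a + 1) v"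
proof -
  have "(v \<bullet> v) * riesz (a + 2) v = riesz (a + 1) v"
    using assms powr_mult_base[of "v \<bullet> v" "- a - 2"] by (simp add: riesz_def algebra_simps)
  moreover have "(\<Sum>e\<in>Basis. (v \<bullet> e)\<^sup>2) = v \<bullet> v"
    by (simp add: euclidean_inner[of v v] power2_eq_square)
  moreover have "(\<Sum>e\<in>Basis. riesz_dd a e v) =
      4 * a * (a + 1) * ((\<Sum>e\<in>Basis. (v \<bullet> e)\<^sup>2) * riesz (a + 2) v) - DIM('a) * (2 * a * riesz (a + 1) v)"
    by (simp add: riesz_dd_def sum_subtractf sum_distrib_left sum_distrib_right mult.assoc)
  ultimately show ?thesis
    by (simp add: algebra_simps)
qed

text \<open>Taylor expansion about \<open>v\<close> in the directions \<open>e\<close> and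
  \<open>-e\<close>; the first-order terms cancel. The Lagrange remainder leaves values of
  \<open>riesz_dd\<close> at intermediate points, from which both a uniform bound and the limit of
  the difference quotients can be read off. The segment avoids the origin because
  \<open>t \<le> d\<close> and \<open>2 * d \<le> norm v\<close>.\<close>

lemma riesz_second_difference:
  fixes v e :: "'a::euclidean_space"
  assumes e: "norm e = 1" and t: "0 < t" "t \<le> d" and v: "2 * d \<le> norm v"
  shows "\<exists>r1 r2. \<bar>r1\<bar> \<le> t \<and> \<bar>r2\<bar> \<le> t \<and>
    riesz a (v + t *\<^sub>R e) + riesz a (v - t *\<^sub>R e) - 2 * riesz a v =
    t\<^sup>2 / 2 * (riesz_dd a e (v + r1 *\<^sub>R e) + riesz_dd a e (v + r2 *\<^sub>R e))"
proof -
  define g1 where "g1 = (\<lambda>r. - 2 * a * (r + v \<bullet> e) * riesz (a + 1) (v + r *\<^sub>R e))"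
  \<comment> \<open>The successive derivatives along the line, in the form that
    \<open>Taylor\<close> expects; only the indices 0, 1 and 2 matter.\<close>
  define D where "D m = (if m = 0 then \<lambda>r. riesz a (v + r *\<^sub>R e)
    else if m = 1 then g1 else (\<lambda>r. riesz_dd a e (v + r *\<^sub>R e)))" for m :: nat
  have ee: "e \<bullet> e = 1" using e by (simp add: dot_square_norm)
  have q: "(v + r *\<^sub>R e) \<bullet> (v + r *\<^sub>R e) = v \<bullet> v + 2 * r * (v \<bullet> e) + r\<^sup>2" for r
    by (simp add: inner_add_left inner_add_right ee power2_eq_square inner_commute[of e v] algebra_simps)
  have pos: "(v + r *\<^sub>R e) \<bullet> (v + r *\<^sub>R e) > 0" if "\<bar>r\<bar> \<le> t" for r
  proof -
    have "norm (r *\<^sub>R e) < norm v" using that e t v by simp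
    then have "v + r *\<^sub>R e \<noteq> 0"
      by (metis add.commute add_eq_0_iff norm_minus_cancel less_irrefl)
    then show ?thesis by simp
  qed
  have derq: "((\<lambda>r. riesz b (v + r *\<^sub>R e)) has_real_derivative
      - 2 * b * (r + v \<bullet> e) * riesz (b + 1) (v + r *\<^sub>R e)) (at r)" if "\<bar>r\<bar> \<le> t" for b r
  proof -
    have "((\<lambda>r. v \<bullet> v + 2 * r * (v \<bullet> e) + r\<^sup>2) has_real_derivative 2 * (r + v \<bullet> e)) (at r)"
      by (auto intro!: derivative_eq_intros)
    from DERIV_fun_powr[OF this, of "- b"] pos[OF that] show ?thesis
      unfolding riesz_def q by (simp add: mult_ac)
  qed
  have der: "(D m has_real_derivative D (Suc m) r) (at r)" if "m < 2" "\<bar>r\<bar> \<le> t" for m r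
  proof (cases "m = 0")
    case True
    then show ?thesis using derq[OF that(2)] by (simp add: D_def g1_def)
  next
    case False
    then have "m = 1" using that by simp
    moreover have "(g1 has_real_derivative riesz_dd a e (v + r *\<^sub>R e)) (at r)"
    proof -
      have "((\<lambda>r. - 2 * a * (r + v \<bullet> e)) has_real_derivative - 2 * a) (at r)"
        by (auto intro!: derivative_eq_intros)
      from DERIV_mult[OF this derq[OF that(2), of "a + 1"]] show ?thesis
        by (simp add: g1_def riesz_dd_def ee inner_add_left power2_eq_square algebra_simps)
    qed
    ultimately show ?thesis by (simp add: D_def)
  qed
  have T: "\<exists>r. \<bar>r\<bar> \<le> t \<and> riesz a (v + x *\<^sub>R e) = riesz a v + g1 0 * x + riesz_dd a e (v + r *\<^sub>R e) / 2 * x\<^sup>2"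
    if x: "\<bar>x\<bar> \<le> t" "x \<noteq> 0" for x
  proof -
    have "\<exists>r. (if x < 0 then x < r \<and> r < 0 else 0 < r \<and> r < x) \<and>
      D 0 x = (\<Sum>m<2. D m 0 / fact m * (x - 0) ^ m) + D 2 r / fact 2 * (x - 0) ^ 2"
      by (rule Taylor[of 2 D "D 0" "- t" t 0 x]) (use der x t in auto)
    then obtain r where r: "if x < 0 then x < r \<and> r < 0 else 0 < r \<and> r < x"
      and "D 0 x = (\<Sum>m<2. D m 0 / fact m * (x - 0) ^ m) + D 2 r / fact 2 * (x - 0) ^ 2"
      by blast
    moreover have "\<bar>r\<bar> \<le> t"
      using r x(1) by (auto split: if_splits)
    ultimately show ?thesis
      by (intro exI[of _ r]) (simp add: D_def numeral_2_eq_2)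
  qed
  obtain r1 where r1: "\<bar>r1\<bar> \<le> t" "riesz a (v + t *\<^sub>R e) = riesz a v + g1 0 * t + riesz_dd a e (v + r1 *\<^sub>R e) / 2 * t\<^sup>2"
    using T[of t] t by auto
  obtain r2 where r2: "\<bar>r2\<bar> \<le> t" "riesz a (v - t *\<^sub>R e) = riesz a v - g1 0 * t + riesz_dd a e (v + r2 *\<^sub>R e) / 2 * t\<^sup>2"
    using T[of "- t"] t by auto
  show ?thesis
    using r1 r2 by (intro exI[of _ r1] exI[of _ r2]) (simp add: algebra_simps)
qed

section \<open>Integration against a weight that vanishes off a set\<close>

lemma integrable_mult_bounded_on:
  fixes w \<phi> :: "'a::euclidean_space \<Rightarrow> real"
  assumes "integrable lebesgue w" "\<And>y. y \<notin> K \<Longrightarrow> w y = 0"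
    and "\<phi> \<in> borel_measurable lebesgue" "\<And>y. y \<in> K \<Longrightarrow> \<bar>\<phi> y\<bar> \<le> B"
  shows "integrable lebesgue (\<lambda>y. w y * \<phi> y)"
proof (rule Bochner_Integration.integrable_bound)
  show "integrable lebesgue (\<lambda>y. B * w y)"
    using assms(1) by simp
  show "(\<lambda>y. w y * \<phi> y) \<in> borel_measurable lebesgue"
    using assms(1,3) by (intro borel_measurable_times) auto
  have "\<bar>w y * \<phi> y\<bar> \<le> \<bar>B * w y\<bar>" for y
    using assms(2,4)[of y] mult_right_mono[of "\<bar>\<phi> y\<bar>" "\<bar>B\<bar>" "\<bar>w y\<bar>"]
    by (cases "y \<in> K") (force simp: abs_mult mult.commute)+
  then show "AE y in lebesgue. norm (w y * \<phi> y) \<le> norm (B * w y)"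
    by simp
qed

text \<open>Dominated convergence with a multiple of \<open>\<bar>w\<bar>\<close> as majorant.
  Bounds and limits on \<open>K\<close> suffice, since both integrands vanish elsewhere; the
  singularity of the kernel will lie off \<open>K\<close>.\<close>

lemma integral_mult_tendsto:
  fixes w \<phi> :: "'a::euclidean_space \<Rightarrow> real" and f :: "nat \<Rightarrow> 'a \<Rightarrow> real"
  assumes w: "integrable lebesgue w" "\<And>y. y \<notin> K \<Longrightarrow> w y = 0"
    and "\<And>n. f n \<in> borel_measurable lebesgue" "\<phi> \<in> borel_measurable lebesgue"
    and B: "\<And>n y. y \<in> K \<Longrightarrow> \<bar>f n y\<bar> \<le> B"
    and lim: "\<And>y. y \<in> K \<Longrightarrow> (\<lambda>n. f n y) \<longlonglongrightarrow> \<phi> y"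
  shows "(\<lambda>n. LINT y|lebesgue. w y * f n y) \<longlonglongrightarrow> (LINT y|lebesgue. w y * \<phi> y)"
proof (rule integral_dominated_convergence[where w = "\<lambda>y. \<bar>B * w y\<bar>"])
  show "integrable lebesgue (\<lambda>y. \<bar>B * w y\<bar>)"
    using w by auto
  show "AE y in lebesgue. (\<lambda>n. w y * f n y) \<longlonglongrightarrow> w y * \<phi> y"
  proof (rule AE_I2)
    show "(\<lambda>n. w y * f n y) \<longlonglongrightarrow> w y * \<phi> y" for y
      using tendsto_mult_left[OF lim[of y], of "w y"] w(2)[of y] by (cases "y \<in> K") auto
  qed
  have "\<bar>w y * f n y\<bar> \<le> \<bar>B * w y\<bar>" for n y
    using w(2) B[of y n] mult_right_mono[of "\<bar>f n y\<bar>" "\<bar>B\<bar>" "\<bar>w y\<bar>"]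
    by (cases "y \<in> K") (force simp: abs_mult mult.commute)+
  then show "\<And>n. AE y in lebesgue. norm (w y * f n y) \<le> \<bar>B * w y\<bar>"
    by simp
qed (use w(1) assms(3,4) in \<open>auto intro!: borel_measurable_times\<close>)

lemma borel_imp_lebesgue_measurable:
  fixes f :: "'a::euclidean_space \<Rightarrow> real"
  shows "f \<in> borel_measurable borel \<Longrightarrow> f \<in> borel_measurable lebesgue"
  by (simp add: measurable_completion)

section \<open>Raising the exponent of a vanishing potential\<close>

lemma riesz_bounded_away:
  fixes v :: "'a::euclidean_space"
  assumes "0 \<le> a" "0 < d" "d \<le> norm v"
  shows "\<bar>riesz a v\<bar> \<le> d powr (- 2 * a)"
proof -
  have "riesz a v = norm v powr (- 2 * a)"
    using assms by (simp add: riesz_def dot_square_norm powr_powr flip: powr_numeral)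
  also have "\<dots> \<le> d powr (- 2 * a)"
    using assms by (intro powr_mono2') auto
  finally show ?thesis by (simp add: riesz_def)
qed

text \<open>By Cauchy-Schwarz \<open>(v \<bullet> e)\<^sup>2 \<le> v \<bullet> v\<close>, so both
  terms of \<open>riesz_dd\<close> are controlled by \<open>riesz (a + 1) v\<close>.\<close>

lemma riesz_dd_bounded_away:
  fixes v e :: "'a::euclidean_space"
  assumes "0 \<le> a" "0 < d" "d \<le> norm v" "norm e = 1"
  shows "\<bar>riesz_dd a e v\<bar> \<le> (4 * a * (a + 1) + 2 * a) * d powr (- 2 * (a + 1))"
proof -
  have "(v \<bullet> e)\<^sup>2 \<le> v \<bullet> v"
    using Cauchy_Schwarz_ineq[of v e] assms(4) by (simp add: dot_square_norm)
  then have "(v \<bullet> e)\<^sup>2 * riesz (a + 2) v \<le> (v \<bullet> v) * riesz (a + 2) v"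
    by (intro mult_right_mono) (auto simp: riesz_def)
  also have "\<dots> = riesz (a + 1) v"
    using assms powr_mult_base[of "v \<bullet> v" "- a - 2"] by (simp add: riesz_def algebra_simps)
  finally have 1: "(v \<bullet> e)\<^sup>2 * riesz (a + 2) v \<le> d powr (- 2 * (a + 1))"
    using riesz_bounded_away[of "a + 1" d v] assms by simp
  have 2: "0 \<le> riesz (a + 1) v" "riesz (a + 1) v \<le> d powr (- 2 * (a + 1))"
    "0 \<le> (v \<bullet> e)\<^sup>2 * riesz (a + 2) v"
    using riesz_bounded_away[of "a + 1" d v] assms by (auto simp: riesz_def)
  have "\<bar>riesz_dd a e v\<bar> \<le> (4 * a * (a + 1)) * ((v \<bullet> e)\<^sup>2 * riesz (a + 2) v) + 2 * a * riesz (a + 1) v"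
    unfolding riesz_dd_def using 2 assms(1) by (intro abs_leI) (simp_all add: mult.assoc)
  also have "\<dots> \<le> (4 * a * (a + 1)) * d powr (- 2 * (a + 1)) + 2 * a * d powr (- 2 * (a + 1))"
    using 1 2 assms(1) by (intro add_mono mult_left_mono) auto
  finally show ?thesis by (simp add: algebra_simps)
qed

text \<open>The Laplacian of the potential at \<open>x\<close> is taken as a limit of sums of
  symmetric second difference quotients. Each quotient is zero, as it only involves values of the
  potential in \<open>U\<close>; dominated convergence moves the limit under the integral, where
  \<open>riesz_laplacian\<close> produces the kernel with exponent \<open>a + 1\<close>.\<close>

lemma riesz_potential_raise:
  fixes w :: "'a::euclidean_space \<Rightarrow> real" and a :: real
  assumes w: "integrable lebesgue w" "\<And>y. y \<notin> K \<Longrightarrow> w y = 0"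
    and K: "closed K" and U: "open U" "U \<inter> K = {}"
    and a: "0 < a" "DIM('a) < 2 * a + 2"
    and zero: "\<And>x. x \<in> U \<Longrightarrow> (LINT y|lebesgue. w y * riesz a (x - y)) = 0"
    and x: "x \<in> U"
  shows "(LINT y|lebesgue. w y * riesz (a + 1) (x - y)) = 0"
proof -
  obtain d1 where d1: "d1 > 0" "ball x d1 \<subseteq> U"
    using U(1) x openE by blast
  obtain d2 where d2: "d2 > 0" "\<And>y. y \<in> K \<Longrightarrow> d2 \<le> dist x y"
    using separate_point_closed[OF K, of x] U(2) x by blast
  \<comment> \<open>With this choice a shift of \<open>x\<close> by at most \<open>d\<close> stays
    in \<open>U\<close> and keeps distance at least \<open>d\<close> from \<open>K\<close>.\<close>
  define d where "d = min d1 d2 / 2"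
  have d: "d > 0" "ball x (2 * d) \<subseteq> U" "\<And>y. y \<in> K \<Longrightarrow> 2 * d \<le> norm (x - y)"
    using d1 d2 by (force simp: d_def dist_norm)+
  define t where "t n = d / (real n + 1)" for n
  have t: "0 < t n" "t n \<le> d" for n
    using d(1) by (auto simp: t_def field_simps)
  have t0: "t \<longlonglongrightarrow> 0"
    unfolding t_def by real_asymp
  define \<Delta> where "\<Delta> n e y =
    (riesz a (x - y + t n *\<^sub>R e) + riesz a (x - y - t n *\<^sub>R e) - 2 * riesz a (x - y)) / (t n)\<^sup>2" for n e y
  have meas: "(\<lambda>y. riesz b (z - y)) \<in> borel_measurable lebesgue" for b and z :: 'a
    by (rule borel_imp_lebesgue_measurable) measurable
  have shift: "x - y + t n *\<^sub>R e = (x + t n *\<^sub>R e) - y" "x - y - t n *\<^sub>R e = (x - t n *\<^sub>R e) - y" for y e n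
    by auto
  have meas\<Delta>: "\<Delta> n e \<in> borel_measurable lebesgue" for n e
    unfolding \<Delta>_def[abs_def] shift
    by (intro borel_measurable_divide borel_measurable_diff borel_measurable_add borel_measurable_times
        borel_measurable_const meas)
  have rep: "\<exists>r1 r2. \<bar>r1\<bar> \<le> t n \<and> \<bar>r2\<bar> \<le> t n \<and>
      \<Delta> n e y = (riesz_dd a e (x - y + r1 *\<^sub>R e) + riesz_dd a e (x - y + r2 *\<^sub>R e)) / 2"
    if ey: "e \<in> Basis" "y \<in> K" for n e y
  proof -
    obtain r1 r2 where r: "\<bar>r1\<bar> \<le> t n" "\<bar>r2\<bar> \<le> t n"
      "riesz a (x - y + t n *\<^sub>R e) + riesz a (x - y - t n *\<^sub>R e) - 2 * riesz a (x - y) =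
        (t n)\<^sup>2 / 2 * (riesz_dd a e (x - y + r1 *\<^sub>R e) + riesz_dd a e (x - y + r2 *\<^sub>R e))"
      using riesz_second_difference[OF _ t[of n] d(3)[OF ey(2)], of e a] ey(1) by auto
    have "\<Delta> n e y = (riesz_dd a e (x - y + r1 *\<^sub>R e) + riesz_dd a e (x - y + r2 *\<^sub>R e)) / 2"
      unfolding \<Delta>_def r(3) using t(1)[of n] by simp
    with r(1,2) show ?thesis by blast
  qed
  define B where "B = (4 * a * (a + 1) + 2 * a) * d powr (- 2 * (a + 1))"
  have away: "d \<le> norm (x - y + r *\<^sub>R e)" if "e \<in> Basis" "y \<in> K" "\<bar>r\<bar> \<le> t n" for e y r n
    using norm_triangle_ineq4[of "x - y + r *\<^sub>R e" "r *\<^sub>R e"] d(3)[of y] t(2)[of n] that by simp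
  have bnd: "\<bar>\<Delta> n e y\<bar> \<le> B" if "e \<in> Basis" "y \<in> K" for n e y
  proof -
    have "\<bar>riesz_dd a e (x - y + r *\<^sub>R e)\<bar> \<le> B" if "\<bar>r\<bar> \<le> t n" for r
      unfolding B_def using away[of e y r n] that \<open>e \<in> Basis\<close> \<open>y \<in> K\<close> a d(1)
      by (intro riesz_dd_bounded_away) auto
    with rep[OF that, of n] show ?thesis
      by (auto simp: abs_le_iff) (smt (verit))+
  qed
  have lim: "(\<lambda>n. \<Delta> n e y) \<longlonglongrightarrow> riesz_dd a e (x - y)" if ey: "e \<in> Basis" "y \<in> K" for e y
  proof -
    obtain r1 r2 where r: "\<And>n. \<bar>r1 n\<bar> \<le> t n" "\<And>n. \<bar>r2 n\<bar> \<le> t n"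
      "\<And>n. \<Delta> n e y = (riesz_dd a e (x - y + r1 n *\<^sub>R e) + riesz_dd a e (x - y + r2 n *\<^sub>R e)) / 2"
      using rep[OF ey] by metis
    have "isCont (riesz_dd a e) (x - y)"
      by (rule continuous_on_interior[OF continuous_on_riesz_dd[of "- {0}"]])
        (use d(1) d(3)[OF ey(2)] in \<open>auto simp: interior_open open_Compl\<close>)
    then have *: "(\<lambda>n. riesz_dd a e (x - y + r n *\<^sub>R e)) \<longlonglongrightarrow> riesz_dd a e (x - y)"
      if "\<And>n. \<bar>r n\<bar> \<le> t n" for r
    proof (rule isCont_tendsto_compose)
      have "r \<longlonglongrightarrow> 0"
        by (rule Lim_null_comparison[OF _ t0]) (use that in auto)
      from tendsto_add[OF tendsto_const tendsto_scaleR[OF this tendsto_const]]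
      show "(\<lambda>n. x - y + r n *\<^sub>R e) \<longlonglongrightarrow> x - y"
        by simp
    qed
    show ?thesis
      unfolding r(3) using tendsto_divide[OF tendsto_add[OF *[OF r(1)] *[OF r(2)]] tendsto_const, of 2]
      by simp
  qed
  have int: "integrable lebesgue (\<lambda>y. w y * riesz a (z - y))" if "z \<in> U" for z
  proof -
    obtain d' where "d' > 0" "\<And>y. y \<in> K \<Longrightarrow> d' \<le> dist z y"
      using separate_point_closed[OF K, of z] U(2) \<open>z \<in> U\<close> by blast
    then show ?thesis
      using a(1) by (intro integrable_mult_bounded_on[OF w meas, where B = "d' powr (- 2 * a)"] riesz_bounded_away)
        (auto simp: dist_norm)
  qed
  \<comment> \<open>For fixed \<open>n\<close> and \<open>e\<close> this is a linear combination of
    the potential at three points of \<open>U\<close>. Splitting the integral requires the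
    integrability of each term, provided by \<open>int\<close>.\<close>
  have zero\<Delta>: "(LINT y|lebesgue. w y * (\<Sum>e\<in>Basis. \<Delta> n e y)) = 0" for n
  proof -
    have "integrable lebesgue (\<lambda>y. w y * \<Delta> n e y) \<and> (LINT y|lebesgue. w y * \<Delta> n e y) = 0" if "e \<in> Basis" for e
    proof -
      have "dist x (x + t n *\<^sub>R e) < 2 * d" "dist x (x - t n *\<^sub>R e) < 2 * d"
        using t[of n] that d(1) by (auto simp: dist_norm)
      then have in_U: "x + t n *\<^sub>R e \<in> U" "x - t n *\<^sub>R e \<in> U"
        using d(2) by auto
      have eq: "(\<lambda>y. w y * \<Delta> n e y) = (\<lambda>y. (w y * riesz a ((x + t n *\<^sub>R e) - y)
          + w y * riesz a ((x - t n *\<^sub>R e) - y) - 2 * (w y * riesz a (x - y))) / (t n)\<^sup>2)"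
        by (auto simp: \<Delta>_def shift algebra_simps)
      show ?thesis
        unfolding eq using int[OF in_U(1)] int[OF in_U(2)] int[OF x] zero[OF in_U(1)] zero[OF in_U(2)] zero[OF x]
        by simp
    qed
    then show ?thesis
      by (simp add: sum_distrib_left)
  qed
  have "(\<lambda>n. LINT y|lebesgue. w y * (\<Sum>e\<in>Basis. \<Delta> n e y)) \<longlonglongrightarrow>
    (LINT y|lebesgue. w y * (2 * a * (2 * a + 2 - DIM('a)) * riesz (a + 1) (x - y)))"
  proof (rule integral_mult_tendsto[OF w, where B = "DIM('a) * B"])
    show "\<bar>\<Sum>e\<in>Basis. \<Delta> n e y\<bar> \<le> DIM('a) * B" if "y \<in> K" for n y
      using sum_norm_bound[of Basis "\<lambda>e. \<Delta> n e y" B] bnd that by simp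
    show "(\<lambda>n. \<Sum>e\<in>Basis. \<Delta> n e y) \<longlonglongrightarrow> 2 * a * (2 * a + 2 - DIM('a)) * riesz (a + 1) (x - y)" if "y \<in> K" for y
    proof -
      have "x - y \<noteq> 0" using d(1) d(3)[OF that] by auto
      from riesz_laplacian[OF this, of a, symmetric] show ?thesis
        using lim that by (auto intro!: tendsto_sum)
    qed
  qed (auto intro!: borel_measurable_sum meas\<Delta> borel_measurable_times meas)
  then have "(LINT y|lebesgue. w y * (2 * a * (2 * a + 2 - DIM('a)) * riesz (a + 1) (x - y))) = 0"
    unfolding zero\<Delta> by (simp add: LIMSEQ_const_iff)
  also have "(\<lambda>y. w y * (2 * a * (2 * a + 2 - DIM('a)) * riesz (a + 1) (x - y))) =
      (\<lambda>y. (2 * a * (2 * a + 2 - DIM('a))) * (w y * riesz (a + 1) (x - y)))"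
    by (auto simp: mult_ac)
  \<comment> \<open>The constant factor is positive by the two assumptions on \<open>a\<close>, so
    it cancels.\<close>
  finally show ?thesis
    using a by simp
qed

section \<open>From kernel powers to radial weights\<close>

text \<open>Approximants with error below \<open>1 / Suc n\<close> on \<open>K\<close> are uniformly
  bounded there by a bound of \<open>\<phi>\<close> plus 1, so \<open>integral_mult_tendsto\<close>
  applies. This lets a Weierstrass-type density on \<open>K\<close> be used under the
  integral.\<close>

lemma integral_mult_eq_0_by_approximation:
  fixes w \<phi> :: "'a::euclidean_space \<Rightarrow> real"
  assumes w: "integrable lebesgue w" "\<And>y. y \<notin> K \<Longrightarrow> w y = 0"
    and K: "compact K" and \<phi>: "\<phi> \<in> borel_measurable lebesgue" "continuous_on K \<phi>"
    and approx: "\<And>e. 0 < e \<Longrightarrow> \<exists>g. g \<in> borel_measurable lebesgue \<and> (\<forall>y\<in>K. \<bar>\<phi> y - g y\<bar> < e) \<and>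
      (LINT y|lebesgue. w y * g y) = 0"
  shows "(LINT y|lebesgue. w y * \<phi> y) = 0"
proof -
  have "\<exists>g. g \<in> borel_measurable lebesgue \<and> (\<forall>y\<in>K. \<bar>\<phi> y - g y\<bar> < 1 / Suc n) \<and>
      (LINT y|lebesgue. w y * g y) = 0" for n
    by (rule approx) simp
  then obtain g where "\<forall>n. g n \<in> borel_measurable lebesgue \<and> (\<forall>y\<in>K. \<bar>\<phi> y - g n y\<bar> < 1 / Suc n) \<and>
      (LINT y|lebesgue. w y * g n y) = 0"
    using choice[of "\<lambda>n g. g \<in> borel_measurable lebesgue \<and> (\<forall>y\<in>K. \<bar>\<phi> y - g y\<bar> < 1 / Suc n) \<and>
      (LINT y|lebesgue. w y * g y) = 0"] by blast
  then have g: "\<And>n. g n \<in> borel_measurable lebesgue" "\<And>n y. y \<in> K \<Longrightarrow> \<bar>\<phi> y - g n y\<bar> < 1 / Suc n"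
    "\<And>n. (LINT y|lebesgue. w y * g n y) = 0"
    by blast+
  obtain B where B: "\<And>y. y \<in> K \<Longrightarrow> \<bar>\<phi> y\<bar> \<le> B"
    using compact_imp_bounded[OF compact_continuous_image[OF \<phi>(2) K]] unfolding bounded_iff by auto
  have "(\<lambda>n. LINT y|lebesgue. w y * g n y) \<longlonglongrightarrow> (LINT y|lebesgue. w y * \<phi> y)"
  proof (rule integral_mult_tendsto[OF w g(1) \<phi>(1), where B = "B + 1"])
    show "\<bar>g n y\<bar> \<le> B + 1" if "y \<in> K" for n y
    proof -
      have "1 / real (Suc n) \<le> 1" by simp
      then show ?thesis using g(2)[OF that, of n] B[OF that] by linarith
    qed
    show "(\<lambda>n. g n y) \<longlonglongrightarrow> \<phi> y" if "y \<in> K" for y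
    proof (rule Lim_transform[OF tendsto_const], rule Lim_null_comparison)
      show "\<forall>\<^sub>F n in sequentially. norm (g n y - \<phi> y) \<le> 1 / Suc n"
        using g(2)[OF that] by (auto intro!: always_eventually less_imp_le simp: abs_minus_commute)
    qed (rule LIMSEQ_Suc[OF lim_1_over_n])
  qed
  then show ?thesis
    unfolding g(3) by (simp add: LIMSEQ_const_iff)
qed

text \<open>All powers of \<open>1 / |x - y|\<^sup>2\<close> are available, hence by Weierstrass every radial weight.\<close>

lemma radial_integral_eq_0:
  fixes w :: "'a::euclidean_space \<Rightarrow> real"
  assumes w: "integrable lebesgue w" "\<And>y. y \<notin> K \<Longrightarrow> w y = 0"
    and K: "compact K" "x \<notin> K"
    and a: "0 \<le> a"
    and zero: "\<And>k::nat. (LINT y|lebesgue. w y * riesz (a + k) (x - y)) = 0"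
    and \<phi>: "continuous_on UNIV \<phi>"
  shows "(LINT y|lebesgue. w y * \<phi> ((x - y) \<bullet> (x - y))) = 0"
proof -
  \<comment> \<open>The range of the variable \<open>p\<close>, the inverse squared distance from
    \<open>x\<close>; it is compact because \<open>x\<close> has positive distance from
    \<open>K\<close>.\<close>
  define P where "P = (\<lambda>y. inverse ((x - y) \<bullet> (x - y))) ` K"
  have P: "compact P"
    unfolding P_def using K by (intro compact_continuous_image continuous_intros) auto
  \<comment> \<open>The weight is split as \<open>riesz a\<close> times \<open>h\<close>, because
    only the exponents \<open>a + k\<close> are available: a monomial \<open>p ^ k\<close> times
    \<open>riesz a\<close> is \<open>riesz (a + k)\<close>.\<close>
  define h where "h p = \<phi> (inverse p) * p powr (- a)" for p
  have pos: "0 < (x - y) \<bullet> (x - y)" if "y \<in> K" for y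
    using that K(2) by auto
  have h: "continuous_on P h"
    unfolding h_def P_def using K(2)
    by (intro continuous_intros continuous_on_compose2[OF \<phi>]) (auto simp: right_minus_eq)
  have meas: "(\<lambda>y. riesz b (x - y)) \<in> borel_measurable lebesgue" for b
    by (rule borel_imp_lebesgue_measurable) measurable
  have [measurable]: "\<phi> \<in> borel_measurable borel"
    using \<phi> by (rule borel_measurable_continuous_onI)
  have m\<phi>: "(\<lambda>y. \<phi> ((x - y) \<bullet> (x - y))) \<in> borel_measurable lebesgue"
    by (rule borel_imp_lebesgue_measurable) measurable
  obtain d where d: "d > 0" "\<And>y. y \<in> K \<Longrightarrow> d \<le> dist x y"
    using separate_point_closed[OF compact_imp_closed[OF K(1)] K(2)] by blast
  define C where "C = d powr (- 2 * a)"
  have C: "0 < C" "\<And>y. y \<in> K \<Longrightarrow> \<bar>riesz a (x - y)\<bar> \<le> C"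
    using d riesz_bounded_away[OF a d(1)] by (auto simp: C_def dist_norm)
  show ?thesis
  proof (rule integral_mult_eq_0_by_approximation[OF w K(1) m\<phi>])
    show "continuous_on K (\<lambda>y. \<phi> ((x - y) \<bullet> (x - y)))"
      by (intro continuous_intros continuous_on_compose2[OF \<phi>]) auto
    \<comment> \<open>The error of the polynomial gets multiplied by \<open>riesz a\<close>, which
      is at most \<open>C\<close> on \<open>K\<close>; hence the tolerance
      \<open>e / C\<close>.\<close>
    fix e :: real assume "0 < e"
    then have "0 < e / C" using C by simp
    obtain g where g: "real_polynomial_function g" "\<And>p. p \<in> P \<Longrightarrow> \<bar>h p - g p\<bar> < e / C"
      using Stone_Weierstrass_real_polynomial_function[OF P h \<open>0 < e / C\<close>] by blast
    obtain c n where gs: "g = (\<lambda>p. \<Sum>i\<le>n. c i * p ^ i)"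
      using g(1) real_polynomial_function_iff_sum by blast
    define f where "f y = (\<Sum>i\<le>n. c i * riesz (a + i) (x - y))" for y
    have f: "f y = riesz a (x - y) * g (inverse ((x - y) \<bullet> (x - y)))" if "y \<in> K" for y
      using pos[OF that] unfolding f_def gs sum_distrib_left
      by (intro sum.cong) (auto simp: riesz_def powr_diff powr_realpow power_inverse field_simps)
    have \<phi>h: "\<phi> ((x - y) \<bullet> (x - y)) = riesz a (x - y) * h (inverse ((x - y) \<bullet> (x - y)))" if "y \<in> K" for y
      using pos[OF that] by (simp add: h_def riesz_def powr_minus inverse_powr flip: powr_add)
    have "\<bar>\<phi> ((x - y) \<bullet> (x - y)) - f y\<bar> < e" if "y \<in> K" for y
    proof -
      have "\<bar>h (inverse ((x - y) \<bullet> (x - y))) - g (inverse ((x - y) \<bullet> (x - y)))\<bar> < e / C"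
        using g(2) that by (auto simp: P_def)
      then have "C * \<bar>h (inverse ((x - y) \<bullet> (x - y))) - g (inverse ((x - y) \<bullet> (x - y)))\<bar> < e"
        using C(1) by (simp add: field_simps)
      then show ?thesis
        unfolding f[OF that] \<phi>h[OF that] right_diff_distrib[symmetric] abs_mult
        using mult_right_mono[OF C(2)[OF that]] by (smt (verit) abs_ge_zero)
    qed
    moreover have "f \<in> borel_measurable lebesgue"
      unfolding f_def[abs_def] by (intro borel_measurable_sum borel_measurable_times borel_measurable_const meas)
    moreover have "(LINT y|lebesgue. w y * f y) = 0"
    proof -
      have "integrable lebesgue (\<lambda>y. w y * riesz (a + i) (x - y))" for i :: nat
        using a d by (intro integrable_mult_bounded_on[OF w meas, where B = "d powr (- 2 * (a + i))"] riesz_bounded_away)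
          (auto simp: dist_norm)
      then have "integrable lebesgue (\<lambda>y. c i * (w y * riesz (a + i) (x - y)))" for i :: nat
        by simp
      moreover have "(\<lambda>y. w y * f y) = (\<lambda>y. \<Sum>i\<le>n. c i * (w y * riesz (a + i) (x - y)))"
        by (simp add: f_def sum_distrib_left mult_ac)
      ultimately show ?thesis
        by (simp add: zero)
    qed
    ultimately show "\<exists>g. g \<in> borel_measurable lebesgue \<and> (\<forall>y\<in>K. \<bar>\<phi> ((x - y) \<bullet> (x - y)) - g y\<bar> < e) \<and>
        (LINT y|lebesgue. w y * g y) = 0"
      by blast
  qed
qed

section \<open>The algebra spanned by Gaussians centred in a convex open set\<close>

text \<open>The coefficient \<open>c\<close> in the generators makes closure under addition enough
  to obtain the linear span; \<open>\<tau> = 0\<close> supplies the constants.\<close>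

inductive_set gaussian_sums :: "'a::real_inner set \<Rightarrow> ('a \<Rightarrow> real) set" for U where
  gaussian: "x \<in> U \<Longrightarrow> 0 \<le> \<tau> \<Longrightarrow> (\<lambda>y. c * exp (- \<tau> * ((x - y) \<bullet> (x - y)))) \<in> gaussian_sums U"
| add: "f \<in> gaussian_sums U \<Longrightarrow> g \<in> gaussian_sums U \<Longrightarrow> (\<lambda>y. f y + g y) \<in> gaussian_sums U"

text \<open>Completing the square: the two exponents add up to a quadratic with coefficient
  \<open>\<tau>1 + \<tau>2\<close>, centred at the weighted mean of \<open>x1\<close> and
  \<open>x2\<close>, plus a constant. Convexity keeps the mean in \<open>U\<close>. If both
  coefficients are 0 there is no weighted mean, but the product is constant.\<close>

lemma gaussian_sums_mult_gaussian:
  assumes U: "convex U" and x: "x1 \<in> U" "x2 \<in> U" and \<tau>: "0 \<le> \<tau>1" "0 \<le> \<tau>2"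
  shows "(\<lambda>y. (c1 * exp (- \<tau>1 * ((x1 - y) \<bullet> (x1 - y)))) * (c2 * exp (- \<tau>2 * ((x2 - y) \<bullet> (x2 - y)))))
    \<in> gaussian_sums U"
proof (cases "\<tau>1 + \<tau>2 = 0")
  case True
  then have "\<tau>1 = 0" "\<tau>2 = 0" using \<tau> by auto
  then show ?thesis
    using gaussian_sums.gaussian[OF x(1), of 0 "c1 * c2"] by simp
next
  case False
  define \<tau> where "\<tau> = \<tau>1 + \<tau>2"
  have pos: "0 < \<tau>" using \<tau> False by (simp add: \<tau>_def)
  define z where "z = (\<tau>1 / \<tau>) *\<^sub>R x1 + (\<tau>2 / \<tau>) *\<^sub>R x2"
  have z: "z \<in> U"
    unfolding z_def using \<tau> pos by (intro convexD[OF U x]) (auto simp: \<tau>_def simp flip: add_divide_distrib)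
  have \<tau>z: "\<tau> *\<^sub>R z = \<tau>1 *\<^sub>R x1 + \<tau>2 *\<^sub>R x2"
    using pos by (simp add: z_def scaleR_add_right)
  \<comment> \<open>The constant left over after completing the square; it goes into the coefficient
    as \<open>exp (- q)\<close>.\<close>
  define q where "q = \<tau>1 * (x1 \<bullet> x1) + \<tau>2 * (x2 \<bullet> x2) - \<tau> * (z \<bullet> z)"
  have sq: "\<tau>1 * ((x1 - y) \<bullet> (x1 - y)) + \<tau>2 * ((x2 - y) \<bullet> (x2 - y)) = \<tau> * ((z - y) \<bullet> (z - y)) + q" for y
  proof -
    have "\<tau> * (z \<bullet> y) = \<tau>1 * (x1 \<bullet> y) + \<tau>2 * (x2 \<bullet> y)"
      using arg_cong[OF \<tau>z, of "\<lambda>v. v \<bullet> y"] by (simp add: inner_add_left)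
    moreover have "(p - y) \<bullet> (p - y) = p \<bullet> p - 2 * (p \<bullet> y) + y \<bullet> y" for p
      by (simp add: inner_diff_left inner_diff_right inner_commute[of y p])
    moreover have "\<tau> * (y \<bullet> y) = \<tau>1 * (y \<bullet> y) + \<tau>2 * (y \<bullet> y)"
      by (simp add: \<tau>_def distrib_right)
    ultimately show ?thesis
      by (simp only: q_def distrib_left right_diff_distrib)
  qed
  have "(\<lambda>y. (c1 * exp (- \<tau>1 * ((x1 - y) \<bullet> (x1 - y)))) * (c2 * exp (- \<tau>2 * ((x2 - y) \<bullet> (x2 - y))))) =
      (\<lambda>y. (c1 * c2 * exp (- q)) * exp (- \<tau> * ((z - y) \<bullet> (z - y))))"
  proof
    fix y
    have "exp (- \<tau>1 * ((x1 - y) \<bullet> (x1 - y))) * exp (- \<tau>2 * ((x2 - y) \<bullet> (x2 - y))) =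
        exp (- \<tau>1 * ((x1 - y) \<bullet> (x1 - y)) + - \<tau>2 * ((x2 - y) \<bullet> (x2 - y)))"
      by (rule exp_add[symmetric])
    also have "- \<tau>1 * ((x1 - y) \<bullet> (x1 - y)) + - \<tau>2 * ((x2 - y) \<bullet> (x2 - y)) =
        - q + - \<tau> * ((z - y) \<bullet> (z - y))"
      using sq[of y] by simp
    also have "exp \<dots> = exp (- q) * exp (- \<tau> * ((z - y) \<bullet> (z - y)))"
      by (rule exp_add)
    finally have *: "exp (- \<tau>1 * ((x1 - y) \<bullet> (x1 - y))) * exp (- \<tau>2 * ((x2 - y) \<bullet> (x2 - y))) =
        exp (- q) * exp (- \<tau> * ((z - y) \<bullet> (z - y)))" .
    have "c1 * A * (c2 * B) = c1 * c2 * P * Q" if "A * B = P * Q" for A B P Q :: real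
      by (simp only: mult.assoc mult.left_commute[of _ c2] that)
    from this[OF *]
    show "(c1 * exp (- \<tau>1 * ((x1 - y) \<bullet> (x1 - y)))) * (c2 * exp (- \<tau>2 * ((x2 - y) \<bullet> (x2 - y)))) =
      (c1 * c2 * exp (- q)) * exp (- \<tau> * ((z - y) \<bullet> (z - y)))" .
  qed
  then show ?thesis
    by (simp only: gaussian_sums.gaussian[OF z less_imp_le[OF pos]])
qed

lemma gaussian_sums_mult:
  assumes U: "convex U" and f: "f \<in> gaussian_sums U" and g: "g \<in> gaussian_sums U"
  shows "(\<lambda>y. f y * g y) \<in> gaussian_sums U"
  using f
proof induction
  case f: (gaussian x1 \<tau>1 c1)
  from g show ?case
  proof induction
    case (gaussian x2 \<tau>2 c2)
    show ?case
      by (rule gaussian_sums_mult_gaussian[OF U f(1) gaussian(1) f(2) gaussian(2)])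
  next
    case (add g1 g2)
    then show ?case
      using gaussian_sums.add[OF add.IH] by (simp add: distrib_left)
  qed
next
  case (add f1 f2)
  then show ?case
    using gaussian_sums.add[OF add.IH] by (simp add: distrib_right)
qed

lemma continuous_on_gaussian_sums: "f \<in> gaussian_sums U \<Longrightarrow> continuous_on S f"
  by (induction rule: gaussian_sums.induct) (auto intro!: continuous_intros)

text \<open>Stone-Weierstrass. Two points that no Gaussian separates would be equidistant from every
  centre in \<open>U\<close>, which is impossible since the centres fill a ball.\<close>

lemma gaussian_sums_dense:
  fixes f :: "'a::euclidean_space \<Rightarrow> real"
  assumes U: "convex U" "open U" "U \<noteq> {}" and K: "compact K" and f: "continuous_on K f" and e: "0 < e"
  shows "\<exists>g\<in>gaussian_sums U. \<forall>y\<in>K. \<bar>f y - g y\<bar> < e"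
proof -
  obtain x0 r where r: "0 < r" "ball x0 r \<subseteq> U"
    using U(2,3) openE by blast
  then have x0: "x0 \<in> U" by auto
  interpret function_ring_on "gaussian_sums U" K
  proof
    show "(\<lambda>_. c) \<in> gaussian_sums U" for c
      using gaussian_sums.gaussian[OF x0, of 0 c] by simp
    fix y1 y2 :: 'a assume "y1 \<noteq> y2"
    \<comment> \<open>A vector along \<open>y1 - y2\<close> of length \<open>r / 2\<close>, so that
      \<open>x0 + v\<close> is still an admissible centre. Comparing equidistance at
      \<open>x0\<close> and at \<open>x0 + v\<close> would make \<open>v\<close> orthogonal to
      \<open>y1 - y2\<close>.\<close>
    define v where "v = (r / (2 * norm (y1 - y2))) *\<^sub>R (y1 - y2)"
    have "norm v < r" using r(1) \<open>y1 \<noteq> y2\<close> by (simp add: v_def)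
    then have x1: "x0 + v \<in> U" using r(2) by (auto simp: dist_norm)
    show "\<exists>f\<in>gaussian_sums U. f y1 \<noteq> f y2"
    proof (rule ccontr)
      assume "\<not> ?thesis"
      then have *: "(x - y1) \<bullet> (x - y1) = (x - y2) \<bullet> (x - y2)" if "x \<in> U" for x
        using gaussian_sums.gaussian[OF that, of 1 1] by fastforce
      have "v \<bullet> (y1 - y2) = 0"
        using *[OF x0] *[OF x1] by (simp add: inner_diff_left inner_diff_right inner_add_left inner_add_right inner_commute)
      then show False using r(1) \<open>y1 \<noteq> y2\<close> by (simp add: v_def)
    qed
  qed (fact K continuous_on_gaussian_sums gaussian_sums.add gaussian_sums_mult[OF U(1)])+
  show ?thesis
    using Stone_Weierstrass_basic[OF f e] .
qed

section \<open>Uniqueness for the potential\<close>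

text \<open>Testing with continuous functions that converge almost everywhere to
  \<open>sgn (w y)\<close> gives in the limit that the integral of \<open>\<bar>w\<bar>\<close> is
  0.\<close>

lemma AE_eq_0_if_continuous_tests:
  fixes w :: "'a::euclidean_space \<Rightarrow> real"
  assumes w: "integrable lebesgue w"
    and zero: "\<And>\<phi>. continuous_on UNIV \<phi> \<Longrightarrow> (LINT y|lebesgue. w y * \<phi> y) = 0"
  shows "AE y in lebesgue. w y = 0"
proof -
  have wm: "w \<in> borel_measurable lebesgue"
    using w by simp
  have "(\<lambda>y. sgn (w y)) \<in> borel_measurable lebesgue"
    using wm by (rule measurable_compose) simp
  then have "(\<lambda>y. sgn (w y)) measurable_on UNIV"
    by (simp add: lebesgue_measurable_imp_measurable_on)
  then obtain N g where N: "negligible N" and g: "\<And>n. continuous_on UNIV (g n)"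
    and lim: "\<And>y. y \<notin> N \<Longrightarrow> (\<lambda>n. g n y) \<longlonglongrightarrow> sgn (w y)"
    unfolding measurable_on_def by auto
  \<comment> \<open>Clipping to \<open>[-1, 1]\<close> keeps continuity and leaves the limit
    \<open>sgn (w y)\<close> unchanged, while \<open>\<bar>w\<bar>\<close> becomes a
    majorant.\<close>
  define f where "f n y = max (- 1) (min 1 (g n y))" for n y
  have f: "continuous_on UNIV (f n)" for n
    unfolding f_def by (intro continuous_intros g)
  have limf: "(\<lambda>n. w y * f n y) \<longlonglongrightarrow> \<bar>w y\<bar>" if "y \<notin> N" for y
  proof -
    have "(\<lambda>n. w y * f n y) \<longlonglongrightarrow> w y * max (- 1) (min 1 (sgn (w y)))"
      unfolding f_def by (intro tendsto_intros lim[OF that])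
    also have "w y * max (- 1) (min 1 (sgn (w y))) = \<bar>w y\<bar>"
      by (auto simp: sgn_if)
    finally show ?thesis .
  qed
  have "(\<lambda>n. LINT y|lebesgue. w y * f n y) \<longlonglongrightarrow> (LINT y|lebesgue. \<bar>w y\<bar>)"
  proof (rule integral_dominated_convergence[where w = "\<lambda>y. \<bar>w y\<bar>"])
    have "N \<in> null_sets lebesgue"
      using N by (simp add: negligible_iff_null_sets)
    from AE_not_in[OF this] show "AE y in lebesgue. (\<lambda>n. w y * f n y) \<longlonglongrightarrow> \<bar>w y\<bar>"
      by eventually_elim (rule limf)
    have "\<bar>w y * f n y\<bar> \<le> \<bar>w y\<bar>" for n y
      by (auto simp: f_def abs_mult intro!: mult_left_le)
    then show "\<And>n. AE y in lebesgue. norm (w y * f n y) \<le> \<bar>w y\<bar>"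
      by simp
    show "\<And>n. (\<lambda>y. w y * f n y) \<in> borel_measurable lebesgue"
      by (rule borel_measurable_times[OF wm borel_imp_lebesgue_measurable[OF borel_measurable_continuous_onI[OF f]]])
  qed (use w wm in auto)
  then have "(LINT y|lebesgue. \<bar>w y\<bar>) = 0"
    by (simp add: zero[OF f] LIMSEQ_const_iff)
  then show ?thesis
    using integral_nonneg_eq_0_iff_AE[of lebesgue "\<lambda>y. \<bar>w y\<bar>"] w by simp
qed

lemma riesz_potential_unique:
  fixes w :: "'a::euclidean_space \<Rightarrow> real" and a :: real
  assumes w: "integrable lebesgue w" "\<And>y. y \<notin> K \<Longrightarrow> w y = 0"
    and K: "compact K" and U: "open U" "U \<noteq> {}" "U \<inter> K = {}"
    and a: "0 < a" "DIM('a) < 2 * a + 2"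
    and zero: "\<And>x. x \<in> U \<Longrightarrow> (LINT y|lebesgue. w y * riesz a (x - y)) = 0"
  shows "AE y in lebesgue. w y = 0"
proof -
  \<comment> \<open>The condition on \<open>a\<close> survives each increment, so the exponent can
    be raised repeatedly at all points of \<open>U\<close> at once.\<close>
  have all: "(LINT y|lebesgue. w y * riesz (a + k) (x - y)) = 0" if "x \<in> U" for k :: nat and x
    using that
  proof (induction k arbitrary: x)
    case 0
    then show ?case using zero by simp
  next
    case (Suc k)
    have "(LINT y|lebesgue. w y * riesz ((a + k) + 1) (x - y)) = 0"
      by (rule riesz_potential_raise[OF w compact_imp_closed[OF K] U(1,3) _ _ Suc.IH Suc.prems]) (use a in auto)
    then show ?case by (simp add: add_ac)
  qed
  obtain x0 r where r: "0 < r" "ball x0 r \<subseteq> U"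
    using U(1,2) openE by blast
  \<comment> \<open>Centres are restricted to a ball because \<open>U\<close> need not be convex.
    Integrability is carried through the induction to make the integral additive.\<close>
  have gauss: "integrable lebesgue (\<lambda>y. w y * f y) \<and> (LINT y|lebesgue. w y * f y) = 0"
    if "f \<in> gaussian_sums (ball x0 r)" for f
    using that
  proof induction
    case (gaussian x \<tau> c)
    have x: "x \<in> U" "x \<notin> K" using gaussian(1) r(2) U(3) by auto
    have "continuous_on UNIV (\<lambda>q. c * exp (- \<tau> * q))"
      by (intro continuous_intros)
    from radial_integral_eq_0[OF w K x(2) less_imp_le[OF a(1)] all[OF x(1)] this]
    have "(LINT y|lebesgue. w y * (c * exp (- \<tau> * ((x - y) \<bullet> (x - y))))) = 0" .
    moreover have "integrable lebesgue (\<lambda>y. w y * (c * exp (- \<tau> * ((x - y) \<bullet> (x - y)))))"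
    proof (rule integrable_mult_bounded_on[OF w])
      show "(\<lambda>y. c * exp (- \<tau> * ((x - y) \<bullet> (x - y)))) \<in> borel_measurable lebesgue"
        by (rule borel_imp_lebesgue_measurable) measurable
      have "0 \<le> \<tau> * ((x - y) \<bullet> (x - y))" for y
        using gaussian(2) by simp
      then show "\<bar>c * exp (- \<tau> * ((x - y) \<bullet> (x - y)))\<bar> \<le> \<bar>c\<bar>" for y
        by (simp add: abs_mult mult_left_le)
    qed
    ultimately show ?case by blast
  next
    case (add f g)
    then show ?case by (simp add: distrib_left)
  qed
  show ?thesis
  proof (rule AE_eq_0_if_continuous_tests[OF w(1)])
    fix \<phi> :: "'a \<Rightarrow> real" assume \<phi>: "continuous_on UNIV \<phi>"
    have \<phi>K: "continuous_on K \<phi>"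
      using \<phi> continuous_on_subset by blast
    have meas: "f \<in> borel_measurable lebesgue" if "continuous_on UNIV f" for f :: "'a \<Rightarrow> real"
      by (rule borel_imp_lebesgue_measurable[OF borel_measurable_continuous_onI[OF that]])
    show "(LINT y|lebesgue. w y * \<phi> y) = 0"
    proof (rule integral_mult_eq_0_by_approximation[OF w K meas[OF \<phi>] \<phi>K])
      fix e :: real assume "0 < e"
      then obtain g where "g \<in> gaussian_sums (ball x0 r)" "\<forall>y\<in>K. \<bar>\<phi> y - g y\<bar> < e"
        using gaussian_sums_dense[OF _ _ _ K \<phi>K, of "ball x0 r" e] r(1) by auto
      then show "\<exists>g. g \<in> borel_measurable lebesgue \<and> (\<forall>y\<in>K. \<bar>\<phi> y - g y\<bar> < e) \<and> (LINT y|lebesgue. w y * g y) = 0"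
        using gauss meas[OF continuous_on_gaussian_sums] by blast
    qed
  qed
qed

text \<open>Near a point of \<open>U\<close> the kernel is bounded uniformly for \<open>y\<close> in
  \<open>K\<close>, so dominated convergence applies. Continuity will turn vanishing almost
  everywhere in \<open>U\<close> into vanishing at every point.\<close>

lemma continuous_on_riesz_potential:
  fixes w :: "'a::euclidean_space \<Rightarrow> real"
  assumes w: "integrable lebesgue w" "\<And>y. y \<notin> K \<Longrightarrow> w y = 0"
    and K: "closed K" and U: "open U" "U \<inter> K = {}" and a: "0 \<le> a"
  shows "continuous_on U (\<lambda>x. LINT y|lebesgue. w y * riesz a (x - y))"
proof (rule continuous_at_imp_continuous_on, rule ballI)
  fix x assume x: "x \<in> U"
  obtain d' where d': "d' > 0" "\<And>y. y \<in> K \<Longrightarrow> d' \<le> dist x y"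
    using separate_point_closed[OF K, of x] U(2) x by blast
  define d where "d = d' / 2"
  have d: "0 < d" using d' by (simp add: d_def)
  have away: "d \<le> norm (z - y)" if "z \<in> ball x d" "y \<in> K" for z y
  proof -
    have "d' \<le> dist x z + dist z y"
      using d'(2)[OF that(2)] dist_triangle[of x y z] by linarith
    then show ?thesis using that(1) by (simp add: d_def dist_norm)
  qed
  have "continuous_on (ball x d) (\<lambda>x. LINT y|lebesgue. w y * riesz a (x - y))"
    unfolding continuous_on_sequentially
  proof (intro allI ballI impI)
    fix u z assume z: "z \<in> ball x d" and u': "(\<forall>n. u n \<in> ball x d) \<and> u \<longlonglongrightarrow> z"
    then have u: "\<forall>n. u n \<in> ball x d" "u \<longlonglongrightarrow> z" by blast+
    have meas: "(\<lambda>y. riesz a (p - y)) \<in> borel_measurable lebesgue" for p :: 'a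
      by (rule borel_imp_lebesgue_measurable) measurable
    show "((\<lambda>x. LINT y|lebesgue. w y * riesz a (x - y)) \<circ> u) \<longlonglongrightarrow> (LINT y|lebesgue. w y * riesz a (z - y))"
      unfolding comp_def
    proof (rule integral_mult_tendsto[OF w])
      show "\<bar>riesz a (u n - y)\<bar> \<le> d powr (- 2 * a)" if "y \<in> K" for n y
        using away that u(1) by (intro riesz_bounded_away a d) auto
      show "(\<lambda>n. riesz a (u n - y)) \<longlonglongrightarrow> riesz a (z - y)" if "y \<in> K" for y
      proof (rule isCont_tendsto_compose[where g = "riesz a"])
        show "isCont (riesz a) (z - y)"
          by (rule continuous_on_interior[OF continuous_on_riesz[of "- {0}"]])
            (use d away[OF z that] in \<open>auto simp: interior_open open_Compl\<close>)
        show "(\<lambda>n. u n - y) \<longlonglongrightarrow> z - y"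
          by (intro tendsto_intros u(2))
      qed
    qed (use w(2) meas in blast)+
  qed
  then show "isCont (\<lambda>x. LINT y|lebesgue. w y * riesz a (x - y)) x"
    using d by (simp add: continuous_on_eq_continuous_at)
qed

text \<open>The part of \<open>U\<close> where \<open>f\<close> is nonzero is open, and a nonempty
  open set is not negligible.\<close>

lemma continuous_on_open_AE_eq_0:
  fixes f :: "'a::euclidean_space \<Rightarrow> real"
  assumes U: "open U" and f: "continuous_on U f"
    and ae: "AE x in lebesgue. x \<in> U \<longrightarrow> f x = 0" and x: "x \<in> U"
  shows "f x = 0"
proof (rule ccontr)
  assume "f x \<noteq> 0"
  define V where "V = U \<inter> f -` (- {0})"
  have "open V"
    unfolding V_def by (intro continuous_open_preimage f U open_Compl) auto
  moreover have "x \<in> V" using x \<open>f x \<noteq> 0\<close> by (simp add: V_def)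
  ultimately have "\<not> negligible V"
    using open_not_negligible by blast
  moreover obtain N where "N \<in> null_sets lebesgue" "{x \<in> space lebesgue. \<not> (x \<in> U \<longrightarrow> f x = 0)} \<subseteq> N"
    using ae unfolding eventually_ae_filter by blast
  ultimately show False
    using negligible_subset[of N V] by (auto simp: V_def negligible_iff_null_sets)
qed

section \<open>The nonlocal normal derivative at a fixed time\<close>

text \<open>On the diagonal both sides are 0, by \<open>0 powr _ = 0\<close> and
  \<open>1 / 0 = 0\<close>.\<close>

lemma inverse_kern_eq_riesz:
  fixes x y :: "real ^ 'n"
  shows "1 / kern s x y = riesz (real CARD('n) / 2 + s) (x - y)"
proof (cases "x = y")
  case False
  then have "riesz (real CARD('n) / 2 + s) (x - y) = norm (x - y) powr - (real CARD('n) + 2 * s)"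
    by (simp add: riesz_def dot_square_norm powr_powr distrib_left flip: powr_numeral)
  also have "\<dots> = 1 / kern s x y"
    unfolding kern_def by (rule powr_minus_divide)
  finally show ?thesis by simp
qed (simp add: kern_def riesz_def)

lemma C_Ns_pos: "0 < s \<Longrightarrow> s < 1 \<Longrightarrow> 0 < C_Ns TYPE('n::finite) s"
  unfolding C_Ns_def by (intro divide_pos_pos mult_pos_pos Gamma_real_pos add_pos_nonneg) auto

text \<open>\<open>\<bar>u\<bar> \<le> 1 + u\<^sup>2\<close>, and the constant 1 is integrable over
  a bounded open set.\<close>

lemma L2_imp_integrable_on_bounded:
  fixes u :: "real ^ 'n \<Rightarrow> real"
  assumes "u \<in> L2 UNIV" "open \<Omega>" "bounded \<Omega>"
  shows "integrable lebesgue (\<lambda>y. indicator \<Omega> y * u y)"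
proof (rule Bochner_Integration.integrable_bound)
  have um: "u \<in> borel_measurable lebesgue" and u2: "integrable lebesgue (\<lambda>y. (u y)\<^sup>2)"
    using assms(1) by (auto simp: L2_def lebesgue_on_UNIV_eq)
  have \<Omega>: "\<Omega> \<in> lmeasurable"
    using assms(2,3) by (rule lmeasurable_open[rotated])
  show "integrable lebesgue (\<lambda>y. indicator \<Omega> y + (u y)\<^sup>2)"
    using \<Omega> u2 by (auto simp: fmeasurable_def)
  show "(\<lambda>y. indicator \<Omega> y * u y) \<in> borel_measurable lebesgue"
    using \<Omega> um by (intro borel_measurable_times borel_measurable_indicator) auto
  have "\<bar>indicator \<Omega> y * u y\<bar> \<le> indicator \<Omega> y + (u y)\<^sup>2" for y
  proof -
    have "0 \<le> (\<bar>u y\<bar> - 1)\<^sup>2" by simp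
    then have "2 * \<bar>u y\<bar> \<le> 1 + (u y)\<^sup>2" by (simp add: power2_eq_square algebra_simps)
    then have "\<bar>u y\<bar> \<le> 1 + (u y)\<^sup>2" by (smt (verit) zero_le_power2)
    then show ?thesis by (auto simp: indicator_def)
  qed
  then show "AE y in lebesgue. norm (indicator \<Omega> y * u y) \<le> norm (indicator \<Omega> y + (u y)\<^sup>2)"
    by (auto simp: order_trans[OF _ abs_ge_self])
qed

text \<open>Almost everywhere in \<open>\<O>\<close> the value \<open>u x\<close> is 0, so the
  normal derivative is a nonzero multiple of the potential of \<open>u\<close> restricted to
  \<open>\<Omega>\<close>, and \<open>riesz_potential_unique\<close> applies with
  \<open>K = closure \<Omega>\<close>.\<close>

lemma nonlocal_normal_deriv_unique_continuation:
  fixes \<Omega> \<O> :: "(real ^ 'n) set"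
  assumes \<Omega>: "open \<Omega>" "bounded \<Omega>" and s: "0 < s" "s < 1"
    and u: "u \<in> L2 UNIV" "AE x in lebesgue. x \<notin> \<Omega> \<longrightarrow> u x = 0"
    and \<O>: "open \<O>" "\<O> \<noteq> {}" "\<O> \<inter> \<Omega> = {}"
    and zero: "AE x in lebesgue_on \<O>. nonlocal_normal_deriv s \<Omega> u x = 0"
  shows "AE x in lebesgue. u x = 0"
proof -
  define w where "w y = indicator \<Omega> y * u y" for y
  define a where "a = real CARD('n) / 2 + s"
  \<comment> \<open>Here \<open>2 * a + 2\<close> exceeds the dimension by
    \<open>2 * s + 2\<close>.\<close>
  have a: "0 < a" "DIM(real ^ 'n) < 2 * a + 2"
    using s by (auto simp: a_def add_nonneg_pos)
  have w: "integrable lebesgue w" "\<And>y. y \<notin> closure \<Omega> \<Longrightarrow> w y = 0"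
    using L2_imp_integrable_on_bounded[OF u(1) \<Omega>] closure_subset[of \<Omega>]
    by (auto simp: w_def[abs_def] indicator_def)
  have K: "compact (closure \<Omega>)" using \<Omega>(2) by simp
  \<comment> \<open>An open set that misses \<open>\<Omega>\<close> also misses its closure, so
    \<open>\<O>\<close> lies off the compact set \<open>K\<close>.\<close>
  have disj: "\<O> \<inter> closure \<Omega> = {}"
    using open_Int_closure_eq_empty[OF \<O>(1)] \<O>(3) by blast
  have "AE x in lebesgue. x \<in> \<O> \<longrightarrow> nonlocal_normal_deriv s \<Omega> u x = 0"
    using zero \<O>(1) by (subst (asm) AE_restrict_space_iff) auto
  then have "AE x in lebesgue. x \<in> \<O> \<longrightarrow> (LINT y|lebesgue. w y * riesz a (x - y)) = 0"
    using u(2)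
  proof eventually_elim
    case (elim x)
    show ?case
    proof
      assume x: "x \<in> \<O>"
      then have "u x = 0" using elim(2) \<O>(3) by blast
      have "(LINT y|lebesgue_on \<Omega>. (u x - u y) / kern s x y) =
          (LINT y|lebesgue. indicator \<Omega> y *\<^sub>R ((u x - u y) / kern s x y))"
        using \<Omega>(1) by (intro integral_restrict_space) simp
      also have "(\<lambda>y. indicator \<Omega> y *\<^sub>R ((u x - u y) / kern s x y)) = (\<lambda>y. - (w y * riesz a (x - y)))"
        unfolding a_def inverse_kern_eq_riesz[symmetric] w_def using \<open>u x = 0\<close> by auto
      also have "(LINT y|lebesgue. - (w y * riesz a (x - y))) = - (LINT y|lebesgue. w y * riesz a (x - y))"
        by simp
      finally show "(LINT y|lebesgue. w y * riesz a (x - y)) = 0"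
        using elim(1) x C_Ns_pos[OF s, where 'n = 'n] by (simp add: nonlocal_normal_deriv_def)
    qed
  qed
  from continuous_on_open_AE_eq_0[OF \<O>(1) continuous_on_riesz_potential[OF w closed_closure \<O>(1) disj] this]
  have "(LINT y|lebesgue. w y * riesz a (x - y)) = 0" if "x \<in> \<O>" for x
    using that a(1) by simp
  from riesz_potential_unique[OF w K \<O>(1,2) disj a this]
  have "AE y in lebesgue. w y = 0" .
  then show ?thesis
    using u(2) by eventually_elim (auto simp: w_def indicator_def split: if_splits)
qed

section \<open>Continuity in time and the evolution problem\<close>

text \<open>The Gagliardo term is nonnegative. Thus convergence in \<open>Ws2_norm\<close> controls
  the \<open>L2\<close> distance.\<close>

lemma L2_norm_le_Ws2_norm:
  "L2_norm_on UNIV u \<le> Ws2_norm s u"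
proof -
  have "0 \<le> (LINT (x, y)|lebesgue. \<bar>u x - u y\<bar>\<^sup>2 / kern s x y)"
    by (intro integral_nonneg_AE AE_I2) (auto simp: kern_def split: prod.split)
  then show ?thesis
    by (simp add: L2_norm_on_def Ws2_norm_def lebesgue_on_UNIV_eq)
qed

theorem theorem2p4:
  fixes \<Omega> \<O> :: "(real ^ 'n) set"
    and s \<delta> T :: real
    and \<psi>0 \<psi>1 :: "real ^ 'n \<Rightarrow> real"
    and \<psi> \<psi>t :: "real \<Rightarrow> real ^ 'n \<Rightarrow> real"
  assumes "open \<Omega>" and "bounded \<Omega>" and "lipschitz_boundary \<Omega>"
    and "0 < s" and "s < 1" and "0 \<le> \<delta>" and "0 < T"
    and "\<psi>0 \<in> Ws2_0 s \<Omega>" and "\<psi>1 \<in> L2 \<Omega>"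
    and "weak_solution \<Omega> s \<delta> T \<psi>0 \<psi>1 \<psi> \<psi>t"
    and "open \<O>" and "\<O> \<noteq> {}" and "\<O> \<subseteq> UNIV - \<Omega>"
    and "AE t in lebesgue_on {0<..<T}. AE x in lebesgue_on \<O>.
           nonlocal_normal_deriv s \<Omega> (\<psi> t) x = 0"
  shows "\<forall>t \<in> {0<..<T}. AE x in lebesgue_on \<Omega>. \<psi> t x = 0"
proof
  fix t assume t: "t \<in> {0<..<T}"
  have mem: "\<psi> r \<in> L2 UNIV" "AE x in lebesgue. x \<notin> \<Omega> \<longrightarrow> \<psi> r x = 0" if "r \<in> {0<..<T}" for r
    using assms(10) that by (auto simp: weak_solution_def Ws2_0_def Ws2_def)
  have "AE r in lebesgue. r \<in> {0<..<T} \<longrightarrow> (AE x in lebesgue_on \<O>. nonlocal_normal_deriv s \<Omega> (\<psi> r) x = 0)"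
    using assms(14) by (subst (asm) AE_restrict_space_iff) auto
  then have ae: "AE r in lebesgue. r \<in> {0<..<T} \<longrightarrow> (AE x in lebesgue. \<psi> r x = 0)"
  proof eventually_elim
    case (elim r)
    show ?case
      using nonlocal_normal_deriv_unique_continuation[OF assms(1,2,4,5) mem assms(11,12)] elim assms(13) by blast
  qed
  define c where "c = L2_norm_on UNIV (\<psi> t)"
  \<comment> \<open>If \<open>c > 0\<close>, continuity puts \<open>\<psi> r\<close> closer than
    \<open>c\<close> to \<open>\<psi> t\<close> for all \<open>r\<close> near \<open>t\<close>,
    whereas \<open>\<psi> r = 0\<close> almost everywhere would force the distance to be at least
    \<open>c\<close>. So a punctured neighbourhood of \<open>t\<close> would consist of exceptional
    times, which form a null set.\<close>
  have "c = 0"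
  proof (rule ccontr)
    assume "c \<noteq> 0"
    then have c: "0 < c"
      unfolding c_def L2_norm_on_def by (simp add: order_less_le)
    have "((\<lambda>r. Ws2_norm s (\<lambda>x. \<psi> r x - \<psi> t x)) \<longlongrightarrow> 0) (at t within {0..T})"
      using assms(10) t by (auto simp: weak_solution_def continuous_wrt_def)
    then have "\<forall>\<^sub>F r in at t within {0..T}. Ws2_norm s (\<lambda>x. \<psi> r x - \<psi> t x) < c"
      using c by (rule order_tendstoD)
    then have "\<forall>\<^sub>F r in at t. Ws2_norm s (\<lambda>x. \<psi> r x - \<psi> t x) < c"
      using t at_within_interior[of t "{0..T}"] by (simp add: interior_atLeastAtMost_real)
    moreover have "\<forall>\<^sub>F r in at t. r \<in> {0<..<T}"
      using t by (intro eventually_at_in_open') auto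
    ultimately have "\<forall>\<^sub>F r in at t. r \<in> {0<..<T} \<and> Ws2_norm s (\<lambda>x. \<psi> r x - \<psi> t x) < c"
      by eventually_elim simp
    then obtain S where S: "open S" "t \<in> S" "\<And>r. r \<in> S \<Longrightarrow> r \<noteq> t \<Longrightarrow> r \<in> {0<..<T} \<and> Ws2_norm s (\<lambda>x. \<psi> r x - \<psi> t x) < c"
      unfolding eventually_at_topological by blast
    have "\<not> (AE x in lebesgue. \<psi> r x = 0)" if "r \<in> S" "r \<noteq> t" for r
    proof
      assume r0: "AE x in lebesgue. \<psi> r x = 0"
      have "(LINT x|lebesgue. (\<psi> r x - \<psi> t x)\<^sup>2) = (LINT x|lebesgue. (\<psi> t x)\<^sup>2)"
      proof (rule integral_cong_AE)
        have m: "\<psi> r \<in> borel_measurable lebesgue" "\<psi> t \<in> borel_measurable lebesgue"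
          using mem(1)[OF t] mem(1)[of r] S(3)[OF that] by (auto simp: L2_def lebesgue_on_UNIV_eq)
        show "(\<lambda>x. (\<psi> r x - \<psi> t x)\<^sup>2) \<in> borel_measurable lebesgue" "(\<lambda>x. (\<psi> t x)\<^sup>2) \<in> borel_measurable lebesgue"
          using m by (auto intro!: borel_measurable_power borel_measurable_diff)
        show "AE x in lebesgue. (\<psi> r x - \<psi> t x)\<^sup>2 = (\<psi> t x)\<^sup>2"
          using r0 by eventually_elim simp
      qed
      then have "c \<le> Ws2_norm s (\<lambda>x. \<psi> r x - \<psi> t x)"
        using L2_norm_le_Ws2_norm[of "\<lambda>x. \<psi> r x - \<psi> t x" s] by (simp add: c_def L2_norm_on_def lebesgue_on_UNIV_eq)
      then show False using S(3)[OF that] by simp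
    qed
    \<comment> \<open>The limit at \<open>t\<close> says nothing about \<open>t\<close> itself;
      adding this single point keeps the set negligible.\<close>
    then have sub: "S \<subseteq> insert t {r. \<not> (r \<in> {0<..<T} \<longrightarrow> (AE x in lebesgue. \<psi> r x = 0))}"
      using S(3) by blast
    obtain N where N: "N \<in> null_sets lebesgue" "{r \<in> space lebesgue. \<not> (r \<in> {0<..<T} \<longrightarrow> (AE x in lebesgue. \<psi> r x = 0))} \<subseteq> N"
      using ae unfolding eventually_ae_filter by blast
    have "negligible (insert t N)"
      using N(1) by (simp add: negligible_iff_null_sets negligible_insert)
    then have "negligible S"
      by (rule negligible_subset) (use sub N(2) in auto)
    then show False
      using open_not_negligible[OF S(1)] S(2) by blast
  qed
  then have "(LINT x|lebesgue. (\<psi> t x)\<^sup>2) = 0"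
    by (simp add: c_def L2_norm_on_def lebesgue_on_UNIV_eq)
  then have "AE x in lebesgue. (\<psi> t x)\<^sup>2 = 0"
    using mem(1)[OF t] by (subst (asm) integral_nonneg_eq_0_iff_AE) (auto simp: L2_def lebesgue_on_UNIV_eq)
  then show "AE x in lebesgue_on \<Omega>. \<psi> t x = 0"
    using assms(1) by (subst AE_restrict_space_iff) auto
qed
end
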